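(* On each of the spaces $c_0$ and $\ell^p$, $1\le p<\infty$, there exists a weighted backward shift which is ultra hypercyclic but not mixing.
   Context: Here $c_0$ is the Banach space of complex sequences $x=(x_n)_{n\ge 0}$ with $x_n\to 0$, with the sup norm, and $\ell^p$ is the Banach space of complex sequences $(x_n)_{n\ge 0}$ with $\|x\|=(\sum_{n\ge 0}|x_n|^p)^{1/p}<\infty$. Let $X$ be one of these spaces. A weighted backward shift $B_w$ on $X$ is given by a bounded sequence $w=(w_n)_{n\ge 1}$ of positive numbers: it is the continuous linear operator $B_w(x_0,x_1,x_2,\dots)=(w_1x_1,w_2x_2,\dots)$. A continuous linear operator $T$ on $X$ is ultra hypercyclic if there exists a (strictly) increasing sequence $(n_k)_{k\ge 1}$ of positive integers such that, for each non-empty open subset $U$ of $X$, $X=\bigcup_{i\ge 1}\bigcap_{k\ge i}T^{n_k}(U)$ (the sequence does not depend on $U$). $T$ is mixing if for all non-empty open subsets $U,V$ of $X$ the set $N(U,V)=\{n\in\mathbb{N}_0: T^n(U)\cap V\ne\emptyset\}$ is cofinite in $\mathbb{N}_0=\{0,1,2,\dots\}$. *)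

theory Defs
  imports "HOL-Analysis.Analysis"
begin

section \<open>The sequence spaces\<close>

definition c0 :: "(nat \<Rightarrow> complex) set" where
  "c0 = {x. x \<longlonglongrightarrow> 0}"

definition c0_norm :: "(nat \<Rightarrow> complex) \<Rightarrow> real" where
  "c0_norm x = (SUP n. cmod (x n))"

definition lp :: "real \<Rightarrow> (nat \<Rightarrow> complex) set" where
  "lp p = {x. summable (\<lambda>n. cmod (x n) powr p)}"

definition lp_norm :: "real \<Rightarrow> (nat \<Rightarrow> complex) \<Rightarrow> real" where
  "lp_norm p x = (\<Sum>n. cmod (x n) powr p) powr (1 / p)"

text \<open>A space is given by its carrier \<open>X\<close> and its norm \<open>N\<close>, with the pointwise vector operations.
  The distance is set to 0 off the carrier only because \<^locale>\<open>Metric_space\<close> asks for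
  nonnegativity and symmetry on the whole type; see \<open>Metric_space_c0\<close> and
  \<open>Metric_space_lp\<close> below.\<close>

definition norm_dist ::
    "(nat \<Rightarrow> complex) set \<Rightarrow> ((nat \<Rightarrow> complex) \<Rightarrow> real) \<Rightarrow> (nat \<Rightarrow> complex) \<Rightarrow> (nat \<Rightarrow> complex) \<Rightarrow> real" where
  "norm_dist X N x y = (if x \<in> X \<and> y \<in> X then N (\<lambda>n. x n - y n) else 0)"

definition norm_topology ::
    "(nat \<Rightarrow> complex) set \<Rightarrow> ((nat \<Rightarrow> complex) \<Rightarrow> real) \<Rightarrow> (nat \<Rightarrow> complex) topology" where
  "norm_topology X N = Metric_space.mtopology X (norm_dist X N)"


section \<open>Operators and their dynamics\<close>

definition continuous_linear_operator ::
    "(nat \<Rightarrow> complex) set \<Rightarrow> ((nat \<Rightarrow> complex) \<Rightarrow> real)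
      \<Rightarrow> ((nat \<Rightarrow> complex) \<Rightarrow> (nat \<Rightarrow> complex)) \<Rightarrow> bool" where
  "continuous_linear_operator X N T \<longleftrightarrow>
     T ` X \<subseteq> X \<and>
     (\<forall>x\<in>X. \<forall>y\<in>X. T (\<lambda>n. x n + y n) = (\<lambda>n. T x n + T y n)) \<and>
     (\<forall>c. \<forall>x\<in>X. T (\<lambda>n. c * x n) = (\<lambda>n. c * T x n)) \<and>
     continuous_map (norm_topology X N) (norm_topology X N) T"

text \<open>Weights are indexed by \<open>n \<ge> 1\<close>; the value \<open>w 0\<close> is irrelevant.\<close>

definition weight_sequence :: "(nat \<Rightarrow> real) \<Rightarrow> bool" where
  "weight_sequence w \<longleftrightarrow> (\<forall>n\<ge>1. w n > 0) \<and> bounded (w ` {1..})"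

definition backward_shift :: "(nat \<Rightarrow> real) \<Rightarrow> (nat \<Rightarrow> complex) \<Rightarrow> (nat \<Rightarrow> complex)" where
  "backward_shift w x = (\<lambda>n. complex_of_real (w (Suc n)) * x (Suc n))"

definition ultra_hypercyclic ::
    "(nat \<Rightarrow> complex) set \<Rightarrow> ((nat \<Rightarrow> complex) \<Rightarrow> real)
      \<Rightarrow> ((nat \<Rightarrow> complex) \<Rightarrow> (nat \<Rightarrow> complex)) \<Rightarrow> bool" where
  "ultra_hypercyclic X N T \<longleftrightarrow>
     (\<exists>s :: nat \<Rightarrow> nat. strict_mono_on {1..} s \<and> (\<forall>k\<ge>1. s k \<ge> 1) \<and>
       (\<forall>U. openin (norm_topology X N) U \<and> U \<noteq> {} \<longrightarrow>
          X = (\<Union>i\<in>{1..}. \<Inter>k\<in>{i..}. (T ^^ s k) ` U)))"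

definition mixing ::
    "(nat \<Rightarrow> complex) set \<Rightarrow> ((nat \<Rightarrow> complex) \<Rightarrow> real)
      \<Rightarrow> ((nat \<Rightarrow> complex) \<Rightarrow> (nat \<Rightarrow> complex)) \<Rightarrow> bool" where
  "mixing X N T \<longleftrightarrow>
     (\<forall>U V. openin (norm_topology X N) U \<and> U \<noteq> {} \<and> openin (norm_topology X N) V \<and> V \<noteq> {} \<longrightarrow>
        finite (- {n. (T ^^ n) ` U \<inter> V \<noteq> {}}))"


section \<open>The norms induce metrics\<close>

lemma Metric_space_norm_dist:
  assumes nonneg: "\<And>x. x \<in> X \<Longrightarrow> 0 \<le> N x"
    and zero: "\<And>x. x \<in> X \<Longrightarrow> N x = 0 \<longleftrightarrow> x = (\<lambda>n. 0)"
    and minus: "\<And>x. N (\<lambda>n. - x n) = N x"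
    and diff: "\<And>x y. x \<in> X \<Longrightarrow> y \<in> X \<Longrightarrow> (\<lambda>n. x n - y n) \<in> X"
    and triangle: "\<And>x y. x \<in> X \<Longrightarrow> y \<in> X \<Longrightarrow> N (\<lambda>n. x n + y n) \<le> N x + N y"
  shows "Metric_space X (norm_dist X N)"
proof
  fix x y
  show "0 \<le> norm_dist X N x y"
    using nonneg diff by (simp add: norm_dist_def)
  show "norm_dist X N x y = norm_dist X N y x"
    using minus[of "\<lambda>n. x n - y n"] by (auto simp: norm_dist_def)
next
  fix x y assume "x \<in> X" "y \<in> X"
  then show "norm_dist X N x y = 0 \<longleftrightarrow> x = y"
    using zero[OF diff] by (auto simp: norm_dist_def fun_eq_iff)
next
  fix x y z assume "x \<in> X" "y \<in> X" "z \<in> X"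
  then show "norm_dist X N x z \<le> norm_dist X N x y + norm_dist X N y z"
    using triangle[OF diff diff, of x y y z] by (simp add: norm_dist_def)
qed

lemma c0_bdd_above: "x \<in> c0 \<Longrightarrow> bdd_above (range (\<lambda>n. cmod (x n)))"
  using Bseq_eq_bounded[of x] convergent_imp_Bseq[of x]
  by (auto simp: c0_def convergent_def Bseq_def bdd_above_def)

theorem Metric_space_c0: "Metric_space c0 (norm_dist c0 c0_norm)"
proof (rule Metric_space_norm_dist)
  have upper: "cmod (x n) \<le> c0_norm x" if "x \<in> c0" for x n
    unfolding c0_norm_def by (rule cSUP_upper) (auto intro: c0_bdd_above that)
  show "0 \<le> c0_norm x" if "x \<in> c0" for x
    using upper[OF that, of 0] norm_ge_zero order_trans by blast
  show "c0_norm x = 0 \<longleftrightarrow> x = (\<lambda>n. 0)" if "x \<in> c0" for x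
    using upper[OF that] by (auto simp: c0_norm_def)
  show "c0_norm (\<lambda>n. - x n) = c0_norm x" for x
    by (simp add: c0_norm_def)
  show "(\<lambda>n. x n - y n) \<in> c0" if "x \<in> c0" "y \<in> c0" for x y
    using that tendsto_diff[of x 0 sequentially y 0] by (simp add: c0_def)
  show "c0_norm (\<lambda>n. x n + y n) \<le> c0_norm x + c0_norm y" if "x \<in> c0" "y \<in> c0" for x y
    unfolding c0_norm_def[of "\<lambda>n. x n + y n"]
    by (rule cSUP_least)
       (auto intro: order_trans[OF norm_triangle_ineq] add_mono upper that)
qed

lemma powr_convex_nonneg:
  fixes t u v p :: real
  assumes "p \<ge> 1" "0 \<le> t" "t \<le> 1" "0 \<le> u" "0 \<le> v"
  shows "((1 - t) * u + t * v) powr p \<le> (1 - t) * u powr p + t * v powr p"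
proof -
  have scale: "(s * r) powr p \<le> s * r powr p" if "0 \<le> s" "s \<le> 1" "0 \<le> r" for s r :: real
  proof (cases "s = 0")
    case False
    then have "s powr p \<le> s powr 1"
      using that assms(1) by (intro powr_mono') auto
    then show ?thesis
      using that False by (simp add: powr_mult mult_right_mono)
  qed simp
  consider "u = 0" | "v = 0" | "u > 0" "v > 0"
    using assms by linarith
  then show ?thesis
  proof cases
    case 3
    then show ?thesis
      using convex_onD[OF powr_convex[OF assms(1)], of t u v] assms by simp
  qed (use scale assms in auto)
qed

lemma lp_norm_powr:
  assumes "p \<ge> 1" "x \<in> lp p"
  shows "(\<Sum>n. cmod (x n) powr p) = lp_norm p x powr p"
proof -
  have "0 \<le> (\<Sum>n. cmod (x n) powr p)"
    using assms by (intro suminf_nonneg) (auto simp: lp_def)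
  then show ?thesis
    using assms(1) by (simp add: lp_norm_def powr_powr)
qed

lemma lp_norm_eq_0_iff:
  assumes "p \<ge> 1" "x \<in> lp p"
  shows "lp_norm p x = 0 \<longleftrightarrow> x = (\<lambda>n. 0)"
  using assms suminf_eq_zero_iff[of "\<lambda>n. cmod (x n) powr p"]
  by (auto simp: lp_norm_def lp_def fun_eq_iff)

lemma lp_Minkowski:
  assumes p: "p \<ge> 1" and x: "x \<in> lp p" and y: "y \<in> lp p"
  shows "(\<lambda>n. x n + y n) \<in> lp p" "lp_norm p (\<lambda>n. x n + y n) \<le> lp_norm p x + lp_norm p y"
proof -
  define a b where "a = lp_norm p x" and "b = lp_norm p y"
  have "(\<lambda>n. x n + y n) \<in> lp p \<and> lp_norm p (\<lambda>n. x n + y n) \<le> a + b"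
  proof (cases "a = 0 \<or> b = 0")
    case True
    then show ?thesis
      using lp_norm_eq_0_iff[OF p x] lp_norm_eq_0_iff[OF p y] x y by (auto simp: a_def b_def)
  next
    case False
    have ab: "a > 0" "b > 0"
      using False by (auto simp: a_def b_def lp_norm_def)
    define t where "t = b / (a + b)"
    have t: "0 \<le> t" "t \<le> 1" "(a + b) * (1 - t) = a" "(a + b) * t = b"
      using ab by (auto simp: t_def field_simps)
    define g where "g n = (a + b) powr p *
      ((1 - t) * (cmod (x n) powr p / a powr p) + t * (cmod (y n) powr p / b powr p))" for n
    have le: "cmod (x n + y n) powr p \<le> g n" for n
    proof -
      have *: "(a + b) * ((1 - t) * (cmod (x n) / a) + t * (cmod (y n) / b))
          = cmod (x n) + cmod (y n)"
        using ab t(3,4) by (simp add: distrib_left flip: mult.assoc)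
      have "cmod (x n + y n) powr p \<le> (cmod (x n) + cmod (y n)) powr p"
        using p by (intro powr_mono2 norm_triangle_ineq) auto
      also have "\<dots> = (a + b) powr p * ((1 - t) * (cmod (x n) / a) + t * (cmod (y n) / b)) powr p"
        unfolding *[symmetric] using ab t by (intro powr_mult)
      also have "\<dots> \<le> g n"
        unfolding g_def
        using powr_convex_nonneg[OF p t(1,2), of "cmod (x n) / a" "cmod (y n) / b"] ab
        by (intro mult_left_mono) (auto simp: powr_divide)
      finally show ?thesis .
    qed
    have "(\<lambda>n. cmod (x n) powr p) sums (a powr p)" "(\<lambda>n. cmod (y n) powr p) sums (b powr p)"
      using x y lp_norm_powr[OF p] by (auto simp: lp_def a_def b_def sums_iff)
    then have "g sums ((a + b) powr p * ((1 - t) * (a powr p / a powr p) + t * (b powr p / b powr p)))"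
      unfolding g_def by (intro sums_mult sums_add sums_divide)
    then have g: "g sums ((a + b) powr p)"
      using ab by simp
    have sm: "summable (\<lambda>n. cmod (x n + y n) powr p)"
      by (rule summable_comparison_test'[OF sums_summable[OF g], of 0]) (use le in auto)
    have "(\<Sum>n. cmod (x n + y n) powr p) \<le> (a + b) powr p"
      using suminf_le[OF le sm sums_summable[OF g]] sums_unique[OF g] by simp
    then have "lp_norm p (\<lambda>n. x n + y n) \<le> ((a + b) powr p) powr (1 / p)"
      unfolding lp_norm_def using p sm by (intro powr_mono2 suminf_nonneg) auto
    also have "\<dots> = a + b"
      using p ab by (simp add: powr_powr)
    finally show ?thesis
      using sm by (simp add: lp_def)
  qed
  then show "(\<lambda>n. x n + y n) \<in> lp p" "lp_norm p (\<lambda>n. x n + y n) \<le> lp_norm p x + lp_norm p y"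
    by (auto simp: a_def b_def)
qed

theorem Metric_space_lp:
  assumes p: "p \<ge> 1"
  shows "Metric_space (lp p) (norm_dist (lp p) (lp_norm p))"
proof (rule Metric_space_norm_dist)
  show "(\<lambda>n. x n - y n) \<in> lp p" if "x \<in> lp p" "y \<in> lp p" for x y
    using lp_Minkowski(1)[OF p that(1), of "\<lambda>n. - y n"] that(2) by (simp add: lp_def)
qed (use lp_norm_eq_0_iff[OF p] lp_Minkowski(2)[OF p] in \<open>auto simp: lp_norm_def\<close>)

end

theory Submission
  imports Defs
begin

text \<open>
  For a weighted backward shift \<open>T\<close>, write \<open>v n\<close> for the product of the first \<open>n\<close> weights.
  Then \<open>T\<^sup>n x\<close> has the entries \<open>v (j + n) / v j * x (j + n)\<close>. A preimage of \<open>y\<close> under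
  \<open>T\<^sup>n\<close> has free coordinates below \<open>n\<close>, followed by the numbers \<open>v j / v (j + n) * y j\<close>. So
  \<open>T\<close> is ultra hypercyclic along \<open>(n\<^sub>k)\<close> as soon as the multipliers \<open>v j / v (j + n\<^sub>k)\<close> are
  bounded uniformly in \<open>j\<close> and \<open>k\<close> and tend to \<open>0\<close> for every fixed \<open>j\<close>
  (\<open>ultra_hypercyclic_backward_shift\<close>). On the other hand, \<open>T\<close> is not mixing if \<open>v\<close> stays
  bounded along some infinite set of indices (\<open>not_mixing_backward_shift\<close>).

  With \<open>v n = 2 ^ height n\<close> the task becomes combinatorial. The height of \<open>n\<close> has to vanish at
  infinitely many dips, to grow by at most \<open>1\<close> per step (so that the weights are bounded; they may
  be as small as needed), to satisfy \<open>height j \<le> height (j + n\<^sub>k) + 1\<close> everywhere, and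
  \<open>height (n\<^sub>k + j)\<close> has to tend to infinity for every \<open>j\<close>. The first three requirements are met
  by a shortest-path distance from the set of dips, where the moves are adding \<open>1\<close> and
  subtracting some \<open>n\<^sub>k\<close>. The tolerance of \<open>1\<close> in the inequality is essential: without it, all the
  numbers obtained from a dip by repeatedly subtracting \<open>n\<^sub>1\<close> would be dips, so the height would
  be bounded by \<open>n\<^sub>1\<close>. The last requirement says that the dips must not lie close to sums of few
  terms of \<open>(n\<^sub>k)\<close>; it holds for \<open>n\<^sub>k = fact k\<close> and the dips \<open>l * fact l\<close>
  (\<open>height_fact_add\<close>), since terms up to \<open>fact l\<close> must be used about \<open>l\<close> times to reach
  \<open>l * fact l\<close>, and the next term exceeds the dip by \<open>fact l\<close>.

  The same weight serves all the spaces; the argument is carried out for the common abstraction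
  \<open>solid_sequence_space\<close>.
\<close>

section \<open>Weighted backward shifts on solid sequence spaces\<close>

definition forward_shift :: "nat \<Rightarrow> (nat \<Rightarrow> complex) \<Rightarrow> (nat \<Rightarrow> complex)" where
  "forward_shift n x = (\<lambda>j. if j < n then 0 else x (j - n))"

text \<open>Weights given as quotients of consecutive values of \<open>v\<close> have telescoping products.\<close>
lemma backward_shift_pow:
  fixes v :: "nat \<Rightarrow> real"
  assumes "\<And>n. v n > 0"
  shows "(backward_shift (\<lambda>n. v n / v (n - 1)) ^^ n) x = (\<lambda>j. of_real (v (j + n) / v j) * x (j + n))"
proof (induction n)
  case 0
  then show ?case using assms by (simp add: less_imp_neq[symmetric])
next
  case (Suc n)
  then show ?case using assms by (simp add: backward_shift_def fun_eq_iff less_imp_neq[symmetric])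
qed

text \<open>What \<^term>\<open>c0\<close> and \<^term>\<open>lp p\<close> have in common and what the dynamics of weighted
  backward shifts depends on: the norm depends monotonically on the moduli of the coordinates,
  forward shifts are isometric, and the tails of each element tend to \<open>0\<close>.\<close>
locale solid_sequence_space =
  fixes X :: "(nat \<Rightarrow> complex) set" and N :: "(nat \<Rightarrow> complex) \<Rightarrow> real"
  assumes metric: "Metric_space X (norm_dist X N)"
    and add_mem: "x \<in> X \<Longrightarrow> y \<in> X \<Longrightarrow> (\<lambda>j. x j + y j) \<in> X"
    and norm_triangle: "x \<in> X \<Longrightarrow> y \<in> X \<Longrightarrow> N (\<lambda>j. x j + y j) \<le> N x + N y"
    and scale_mem: "x \<in> X \<Longrightarrow> (\<lambda>j. c * x j) \<in> X"
    and norm_scale: "x \<in> X \<Longrightarrow> N (\<lambda>j. c * x j) = cmod c * N x"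
    and solid: "y \<in> X \<Longrightarrow> (\<And>j. cmod (x j) \<le> cmod (y j)) \<Longrightarrow> x \<in> X"
    and norm_mono: "y \<in> X \<Longrightarrow> (\<And>j. cmod (x j) \<le> cmod (y j)) \<Longrightarrow> N x \<le> N y"
    and forward_shift_iff: "forward_shift n x \<in> X \<longleftrightarrow> x \<in> X"
    and norm_forward_shift: "x \<in> X \<Longrightarrow> N (forward_shift n x) = N x"
    and tail_tendsto: "x \<in> X \<Longrightarrow> (\<lambda>n. N (\<lambda>j. x (j + n))) \<longlonglongrightarrow> 0"
    and unit_mem: "(\<lambda>j. if j = 0 then 1 else 0) \<in> X"
    and coord_le: "x \<in> X \<Longrightarrow> cmod (x j) \<le> N x"
begin

interpretation Metric_space X "norm_dist X N"
  by (rule metric)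

lemma norm_nonneg: "x \<in> X \<Longrightarrow> 0 \<le> N x"
  using coord_le[of x 0] norm_ge_zero order_trans by blast

lemma diff_mem: "x \<in> X \<Longrightarrow> y \<in> X \<Longrightarrow> (\<lambda>j. x j - y j) \<in> X"
  using add_mem[OF _ scale_mem[of y "-1"]] by simp

lemma zero_mem: "(\<lambda>j. 0) \<in> X"
  using solid[OF unit_mem, of "\<lambda>j. 0"] by simp

lemma drop_mem: "x \<in> X \<Longrightarrow> (\<lambda>j. x (j + n)) \<in> X"
  using solid[of x "forward_shift n (\<lambda>j. x (j + n))"]
  by (auto simp: forward_shift_iff) (auto simp: forward_shift_def)

lemma norm_drop_le: "x \<in> X \<Longrightarrow> N (\<lambda>j. x (j + n)) \<le> N x"
  using norm_mono[of x "forward_shift n (\<lambda>j. x (j + n))"]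
  by (auto simp: norm_forward_shift drop_mem) (auto simp: forward_shift_def)

lemma continuous_linear_backward_shift:
  assumes C: "\<And>n. n \<ge> 1 \<Longrightarrow> \<bar>w n\<bar> \<le> C"
  shows "continuous_linear_operator X N (backward_shift w)"
proof -
  have C0: "0 \<le> C" using C[of 1] by linarith
  have bound: "cmod (backward_shift w x j) \<le> cmod (of_real C * x (j + 1))" for x j
    using C[of "Suc j"] C0 by (simp add: backward_shift_def norm_mult mult_right_mono)
  have Cdrop: "(\<lambda>j. of_real C * x (j + 1)) \<in> X" if "x \<in> X" for x
    using scale_mem[OF drop_mem[OF that]] .
  have mem: "backward_shift w x \<in> X" if "x \<in> X" for x
    using Cdrop[OF that] bound by (rule solid)
  have lip: "N (backward_shift w x) \<le> C * N x" if "x \<in> X" for x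
  proof -
    have "N (backward_shift w x) \<le> N (\<lambda>j. of_real C * x (j + 1))"
      using Cdrop[OF that] bound by (rule norm_mono)
    also have "\<dots> = C * N (\<lambda>j. x (j + 1))"
      using norm_scale[OF drop_mem[OF that, of 1], of "of_real C"] C0 by simp
    also have "\<dots> \<le> C * N x"
      using norm_drop_le[OF that] C0 by (rule mult_left_mono)
    finally show ?thesis .
  qed
  have diff_eq: "(\<lambda>j. backward_shift w x j - backward_shift w y j) = backward_shift w (\<lambda>j. x j - y j)"
    for x y by (simp add: backward_shift_def fun_eq_iff algebra_simps)
  have "continuous_map mtopology mtopology (backward_shift w)"
    unfolding metric_continuous_map[OF metric]
  proof (intro conjI ballI allI impI)
    show "backward_shift w ` X \<subseteq> X" using mem by blast
    fix a and e :: real assume a: "a \<in> X" and e: "e > 0"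
    have "norm_dist X N (backward_shift w a) (backward_shift w x) < e"
      if x: "x \<in> X" "norm_dist X N a x < e / (C + 1)" for x
    proof -
      have "norm_dist X N (backward_shift w a) (backward_shift w x) \<le> C * N (\<lambda>j. a j - x j)"
        using lip[OF diff_mem[OF a x(1)]] a x(1) by (simp add: norm_dist_def mem diff_eq)
      also have "\<dots> \<le> (C + 1) * N (\<lambda>j. a j - x j)"
        using norm_nonneg[OF diff_mem[OF a x(1)]] by (simp add: algebra_simps)
      also have "\<dots> < e"
        using x a C0 by (simp add: norm_dist_def field_simps)
      finally show ?thesis .
    qed
    then show "\<exists>d>0. \<forall>x. x \<in> X \<and> norm_dist X N a x < d \<longrightarrow>
        norm_dist X N (backward_shift w a) (backward_shift w x) < e"
      using e C0 by (intro exI[of _ "e / (C + 1)"]) auto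
  qed
  then show ?thesis
    unfolding continuous_linear_operator_def norm_topology_def
    using mem by (auto simp: backward_shift_def algebra_simps)
qed

text \<open>Pointwise convergence of uniformly bounded multipliers to \<open>0\<close> implies strong convergence:
  a long initial segment of \<open>y\<close> is handled by pointwise convergence, the tail by its small
  norm and the uniform bound.\<close>
lemma norm_multiplier_tendsto_0:
  assumes y: "y \<in> X"
    and bound: "\<And>k j. \<bar>c k j\<bar> \<le> K"
    and lim: "\<And>j. (\<lambda>k. c k j) \<longlonglongrightarrow> 0"
  shows "(\<lambda>k. N (\<lambda>j. of_real (c k j) * y j)) \<longlonglongrightarrow> 0"
proof (rule LIMSEQ_I)
  fix e :: real assume e: "e > 0"
  have K: "0 \<le> K" using bound[of 0 0] by linarith
  have Ny: "0 \<le> N y" using y by (rule norm_nonneg)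
  define d where "d = e / (2 * (N y + 1))"
  have d: "d > 0" "d * N y < e / 2" using e Ny by (auto simp: d_def field_simps)
  have "(\<lambda>n. K * N (\<lambda>j. y (j + n))) \<longlonglongrightarrow> K * 0"
    by (intro tendsto_mult tendsto_const tail_tendsto y)
  then have "\<forall>\<^sub>F n in sequentially. K * N (\<lambda>j. y (j + n)) < e / 2"
    using e by (intro order_tendstoD) auto
  then obtain J where J: "K * N (\<lambda>j. y (j + J)) < e / 2"
    using eventually_happens' sequentially_bot by blast
  have "\<forall>\<^sub>F k in sequentially. \<forall>j\<in>{..<J}. \<bar>c k j\<bar> < d"
    using order_tendstoD(2)[OF tendsto_rabs_zero[OF lim] d(1)]
    by (intro eventually_ball_finite) auto
  then obtain k0 where k0: "\<And>k j. k \<ge> k0 \<Longrightarrow> j < J \<Longrightarrow> \<bar>c k j\<bar> < d"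
    by (auto simp: eventually_sequentially)
  \<comment> \<open>By solidity, the head and the tail need not be separated exactly: the multiplied sequence
    is dominated by \<open>d * y + K * t\<close>, where \<open>t\<close> is the tail of \<open>y\<close> left in place.\<close>
  define t where "t = forward_shift J (\<lambda>j. y (j + J))"
  have t: "t \<in> X" "N t = N (\<lambda>j. y (j + J))"
    using y by (simp_all add: t_def forward_shift_iff norm_forward_shift drop_mem)
  have "N (\<lambda>j. of_real (c k j) * y j) < e" and "0 \<le> N (\<lambda>j. of_real (c k j) * y j)" if k: "k \<ge> k0" for k
  proof -
    have le: "cmod (of_real (c k j) * y j) \<le> cmod (of_real d * y j + of_real K * t j)" for j
    proof (cases "j < J")
      case True
      then show ?thesis using k0[OF k True] d(1)
        by (simp add: t_def forward_shift_def norm_mult mult_right_mono)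
    next
      case False
      then have "of_real d * y j + of_real K * t j = of_real (d + K) * y j"
        by (simp add: t_def forward_shift_def algebra_simps)
      moreover have "\<bar>c k j\<bar> \<le> \<bar>d + K\<bar>" using bound[of k j] d(1) K by linarith
      ultimately show ?thesis
        by (simp only: norm_mult norm_of_real mult_right_mono norm_ge_zero)
    qed
    have "N (\<lambda>j. of_real (c k j) * y j) \<le> N (\<lambda>j. of_real d * y j + of_real K * t j)"
      by (rule norm_mono[OF add_mem[OF scale_mem[OF y] scale_mem[OF t(1)]] le])
    also have "\<dots> \<le> N (\<lambda>j. of_real d * y j) + N (\<lambda>j. of_real K * t j)"
      by (rule norm_triangle[OF scale_mem[OF y] scale_mem[OF t(1)]])
    also have "\<dots> = d * N y + K * N (\<lambda>j. y (j + J))"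
      using norm_scale[OF y, of "of_real d"] norm_scale[OF t(1), of "of_real K"] d(1) K t(2) by simp
    also have "\<dots> < e" using d(2) J by linarith
    finally show "N (\<lambda>j. of_real (c k j) * y j) < e" .
    show "0 \<le> N (\<lambda>j. of_real (c k j) * y j)"
      by (rule norm_nonneg[OF solid[OF add_mem[OF scale_mem[OF y] scale_mem[OF t(1)]] le]])
  qed
  then show "\<exists>k0. \<forall>k\<ge>k0. norm (N (\<lambda>j. of_real (c k j) * y j) - 0) < e"
    by (auto intro!: exI[of _ k0])
qed

text \<open>The preimages of \<open>y\<close> under the \<open>n\<close>-th iterate have arbitrary first \<open>n\<close>
  coordinates, and the others form the sequence with entries \<open>v j / v (j + n) * y j\<close>, shifted
  forward by \<open>n\<close>. If the norms of these sequences tend to \<open>0\<close> along \<open>s\<close>, then every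
  non-empty open set contains a preimage of \<open>y\<close> under all late iterates: take the first \<open>n\<close> coordinates
  from a point \<open>u\<close> of the set.\<close>
lemma ultra_hypercyclic_backward_shift:
  fixes v :: "nat \<Rightarrow> real"
  assumes v: "\<And>n. v n > 0"
    and step: "\<And>n. v (Suc n) \<le> C * v n"
    and s: "strict_mono_on {1..} s" "\<And>k. k \<ge> 1 \<Longrightarrow> s k \<ge> 1"
    and bound: "\<And>j k. v j \<le> K * v (j + s k)"
    and lim: "\<And>j. (\<lambda>k. v j / v (j + s k)) \<longlonglongrightarrow> 0"
  shows "ultra_hypercyclic X N (backward_shift (\<lambda>n. v n / v (n - 1)))"
proof -
  define T where "T = backward_shift (\<lambda>n. v n / v (n - 1))"
  have T_pow: "(T ^^ n) x = (\<lambda>j. of_real (v (j + n) / v j) * x (j + n))" for n x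
    unfolding T_def using v by (rule backward_shift_pow)
  have "continuous_linear_operator X N T"
    unfolding T_def
  proof (rule continuous_linear_backward_shift)
    fix n :: nat assume "n \<ge> 1"
    then show "\<bar>v n / v (n - 1)\<bar> \<le> C"
      using step[of "n - 1"] v[of n] v[of "n - 1"] by (simp add: field_simps)
  qed
  then have T_mem: "T x \<in> X" if "x \<in> X" for x
    using that by (auto simp: continuous_linear_operator_def)
  have Tn_mem: "(T ^^ n) x \<in> X" if "x \<in> X" for n x
    using that by (induction n) (auto simp: T_mem)
  have s_inf: "filterlim s at_top sequentially"
  proof (rule filterlim_at_top_mono[OF filterlim_ident])
    have "k \<le> s k" if "k \<ge> 1" for k
      using that
    proof (induction k rule: dec_induct)
      case base
      show ?case using s(2) by simp
    next
      case (step k)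
      then have "s k < s (Suc k)" using s(1) by (simp add: strict_mono_on_def)
      then show ?case using step by simp
    qed
    then show "\<forall>\<^sub>F k in sequentially. k \<le> s k"
      by (auto simp: eventually_sequentially)
  qed
  have hit: "\<exists>i\<ge>1. \<forall>k\<ge>i. y \<in> (T ^^ s k) ` U"
    if U: "openin mtopology U" "U \<noteq> {}" and y: "y \<in> X" for U y
  proof -
    obtain u where uU: "u \<in> U" using U(2) by blast
    with U(1) have u: "u \<in> X" by (auto simp: openin_mtopology)
    obtain r where r: "r > 0" and ball: "mball u r \<subseteq> U"
      using U(1) uU by (meson openin_mtopology)
    define c where "c k j = v j / v (j + s k)" for k j
    define p where "p k = (\<lambda>j. of_real (c k j) * y j)" for k
    define q where "q k = (\<lambda>j. u (j + s k))" for k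
    have c_bound: "\<bar>c k j\<bar> \<le> K" for k j
      using bound[of j k] v[of j] v[of "j + s k"] by (simp add: c_def field_simps)
    have p: "p k \<in> X" for k
    proof (rule solid[OF scale_mem[OF y, of "of_real K"]])
      show "cmod (p k j) \<le> cmod (of_real K * y j)" for j
        using c_bound[of k j] by (simp add: p_def norm_mult mult_right_mono)
    qed
    have q: "q k \<in> X" for k
      using drop_mem[OF u] by (simp add: q_def)
    have "(\<lambda>k. N (p k)) \<longlonglongrightarrow> 0"
      unfolding p_def using y c_bound lim by (intro norm_multiplier_tendsto_0) (auto simp: c_def)
    moreover have "(\<lambda>k. N (q k)) \<longlonglongrightarrow> 0"
      unfolding q_def by (rule filterlim_compose[OF tail_tendsto[OF u] s_inf])
    ultimately have "(\<lambda>k. N (q k) + N (p k)) \<longlonglongrightarrow> 0 + 0"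
      by (rule tendsto_add[rotated])
    then have "\<forall>\<^sub>F k in sequentially. N (q k) + N (p k) < r"
      using r by (intro order_tendstoD) auto
    then obtain i where i: "\<And>k. k \<ge> i \<Longrightarrow> N (q k) + N (p k) < r"
      by (auto simp: eventually_sequentially)
    have "y \<in> (T ^^ s k) ` U" if k: "k \<ge> i" for k
    proof -
      \<comment> \<open>\<open>z\<close> has the first \<open>s k\<close> coordinates of \<open>u\<close>, followed by those of \<open>p k\<close>.\<close>
      define d where "d = forward_shift (s k) (\<lambda>j. q k j - p k j)"
      define z where "z = (\<lambda>j. u j - d j)"
      have d: "d \<in> X"
        by (simp add: d_def forward_shift_iff diff_mem p q)
      have z: "z \<in> X"
        using diff_mem[OF u d] by (simp add: z_def)
      have "N d = N (\<lambda>j. q k j - p k j)"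
        by (simp add: d_def norm_forward_shift diff_mem p q)
      also have "\<dots> \<le> N (q k) + N (p k)"
        using norm_triangle[OF q scale_mem[OF p], of k "-1" k] norm_scale[OF p, of "-1"] by simp
      finally have "norm_dist X N u z < r"
        using i[OF k] u z by (simp add: norm_dist_def z_def)
      then have "z \<in> U" using ball u z by auto
      moreover have "(T ^^ s k) z = y"
        using v by (simp add: T_pow fun_eq_iff z_def d_def q_def p_def c_def forward_shift_def less_imp_neq[symmetric])
      ultimately show ?thesis by blast
    qed
    then show ?thesis by (intro exI[of _ "max 1 i"]) auto
  qed
  show ?thesis
    unfolding ultra_hypercyclic_def norm_topology_def T_def[symmetric]
  proof (intro exI[of _ s] conjI allI impI s)
    fix U assume U: "openin mtopology U \<and> U \<noteq> {}"
    then have "U \<subseteq> X" by (auto simp: openin_mtopology)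
    then have "(T ^^ s i) ` U \<subseteq> X" for i using Tn_mem by blast
    then show "X = (\<Union>i\<in>{1..}. \<Inter>k\<in>{i..}. (T ^^ s k) ` U)"
    proof (intro equalityI subsetI)
      fix y assume "y \<in> X"
      then obtain i where "i \<ge> 1" "\<forall>k\<ge>i. y \<in> (T ^^ s k) ` U"
        using hit U by blast
      then show "y \<in> (\<Union>i\<in>{1..}. \<Inter>k\<in>{i..}. (T ^^ s k) ` U)"
        by (intro UN_I[of i] INT_I) auto
    next
      fix y assume "y \<in> (\<Union>i\<in>{1..}. \<Inter>k\<in>{i..}. (T ^^ s k) ` U)"
      then obtain i where "y \<in> (T ^^ s i) ` U" by (meson INT_E UN_E atLeast_iff order_refl)
      then show "y \<in> X" using \<open>\<And>i. (T ^^ s i) ` U \<subseteq> X\<close> by blast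
    qed
  qed auto
qed

text \<open>If \<open>v n \<le> B * v 0\<close>, then the \<open>n\<close>-th iterate maps the unit ball to sequences
  whose coordinate \<open>0\<close> is at most \<open>B\<close> in modulus, so the image misses the unit ball around
  a vector whose coordinate \<open>0\<close> is \<open>B + 1\<close>.\<close>
lemma not_mixing_backward_shift:
  fixes v :: "nat \<Rightarrow> real"
  assumes v: "\<And>n. v n > 0"
    and inf: "infinite {n. v n \<le> B * v 0}"
  shows "\<not> mixing X N (backward_shift (\<lambda>n. v n / v (n - 1)))"
proof
  define T where "T = backward_shift (\<lambda>n. v n / v (n - 1))"
  have T_pow: "(T ^^ n) x = (\<lambda>j. of_real (v (j + n) / v j) * x (j + n))" for n x
    unfolding T_def using v by (rule backward_shift_pow)
  define b where "b = (\<lambda>j::nat. of_real (B + 1) * (if j = 0 then 1 else 0 :: complex))"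
  have b: "b \<in> X" unfolding b_def by (rule scale_mem[OF unit_mem])
  assume "mixing X N (backward_shift (\<lambda>n. v n / v (n - 1)))"
  then have "finite (- {n. (T ^^ n) ` mball (\<lambda>j. 0) 1 \<inter> mball b 1 \<noteq> {}})"
    unfolding mixing_def norm_topology_def T_def[symmetric]
    using b zero_mem by (simp add: mball_eq_empty)
  moreover have "{n. v n \<le> B * v 0} \<subseteq> - {n. (T ^^ n) ` mball (\<lambda>j. 0) 1 \<inter> mball b 1 \<noteq> {}}"
  proof clarify
    fix n assume n: "v n \<le> B * v 0" and "(T ^^ n) ` mball (\<lambda>j. 0) 1 \<inter> mball b 1 \<noteq> {}"
    then obtain x where x: "x \<in> mball (\<lambda>j. 0) 1" and Tx: "(T ^^ n) x \<in> mball b 1"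
      by blast
    from x have xX: "x \<in> X" and "N (\<lambda>j. 0 - x j) < 1" by (auto simp: norm_dist_def)
    then have "cmod (x n) < 1"
      using coord_le[OF diff_mem[OF zero_mem xX], of n] by simp
    moreover have vB: "v n / v 0 \<le> B" "0 < v n / v 0" using n v[of 0] v[of n] by (auto simp: field_simps)
    ultimately have "(v n / v 0) * cmod (x n) \<le> B * 1"
      by (intro mult_mono) auto
    then have small: "cmod ((T ^^ n) x 0) \<le> B"
      using v[of n] v[of 0] by (simp add: T_pow norm_mult norm_divide)
    have "N (\<lambda>j. b j - (T ^^ n) x j) < 1" and TX: "(T ^^ n) x \<in> X"
      using Tx b by (auto simp: norm_dist_def)
    then have "cmod (b 0 - (T ^^ n) x 0) < 1"
      using coord_le[OF diff_mem[OF b TX], of 0] by simp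
    moreover have "b 0 = of_real (B + 1)" by (simp add: b_def)
    then have "B + 1 \<le> cmod (b 0)" by (simp only: norm_of_real abs_ge_self)
    ultimately show False
      using small norm_triangle_ineq2[of "b 0" "(T ^^ n) x 0"] by linarith
  qed
  ultimately show False using inf finite_subset by blast
qed
end

section \<open>The spaces of null sequences and of p-summable sequences are solid sequence spaces\<close>

lemma c0_coord_le: "x \<in> c0 \<Longrightarrow> cmod (x n) \<le> c0_norm x"
  unfolding c0_norm_def by (rule cSUP_upper) (auto intro: c0_bdd_above)

lemma c0_norm_le: "(\<And>n. cmod (x n) \<le> B) \<Longrightarrow> c0_norm x \<le> B"
  unfolding c0_norm_def by (rule cSUP_least) auto

lemma solid_sequence_space_c0: "solid_sequence_space c0 c0_norm"
proof (rule solid_sequence_space.intro)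
  fix x y :: "nat \<Rightarrow> complex" and c :: complex and n j :: nat
  show "(\<lambda>j. x j + y j) \<in> c0" if "x \<in> c0" "y \<in> c0"
    using that tendsto_add[of x 0 sequentially y 0] by (simp add: c0_def)
  show "c0_norm (\<lambda>j. x j + y j) \<le> c0_norm x + c0_norm y" if "x \<in> c0" "y \<in> c0"
    by (intro c0_norm_le order_trans[OF norm_triangle_ineq] add_mono c0_coord_le that)
  have scale: "(\<lambda>j. c * x j) \<in> c0" if "x \<in> c0" for x c
    using that tendsto_mult_left[of x 0 sequentially c] by (simp add: c0_def)
  then show "(\<lambda>j. c * x j) \<in> c0" if "x \<in> c0" using that .
  show "c0_norm (\<lambda>j. c * x j) = cmod c * c0_norm x" if x: "x \<in> c0"
  proof (rule antisym)
    show "c0_norm (\<lambda>j. c * x j) \<le> cmod c * c0_norm x"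
      using x by (intro c0_norm_le) (simp add: norm_mult mult_left_mono c0_coord_le)
    show "cmod c * c0_norm x \<le> c0_norm (\<lambda>j. c * x j)"
    proof (cases "c = 0")
      case False
      have "c0_norm x \<le> c0_norm (\<lambda>j. c * x j) / cmod c"
      proof (rule c0_norm_le)
        show "cmod (x j) \<le> c0_norm (\<lambda>j. c * x j) / cmod c" for j
          using c0_coord_le[OF scale[OF x, of c], of j] False by (simp add: norm_mult field_simps)
      qed
      then show ?thesis using False by (simp add: field_simps)
    qed (simp add: c0_norm_def)
  qed
  show "x \<in> c0" if "y \<in> c0" "\<And>j. cmod (x j) \<le> cmod (y j)"
    using that Lim_null_comparison[of x "\<lambda>j. cmod (y j)" sequentially]
    by (simp add: c0_def tendsto_norm_zero)
  show "c0_norm x \<le> c0_norm y" if "y \<in> c0" "\<And>j. cmod (x j) \<le> cmod (y j)"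
    using that by (intro c0_norm_le) (meson c0_coord_le order_trans)
  have shift: "forward_shift n x (j + n) = x j" for x j
    by (simp add: forward_shift_def)
  show iff: "forward_shift n x \<in> c0 \<longleftrightarrow> x \<in> c0"
    using LIMSEQ_offset[of "forward_shift n x" n 0]
      LIMSEQ_ignore_initial_segment[of "forward_shift n x" 0 n]
    by (auto simp: c0_def shift)
  show "c0_norm (forward_shift n x) = c0_norm x" if x: "x \<in> c0"
  proof (rule antisym; rule c0_norm_le)
    fix j
    show "cmod (forward_shift n x j) \<le> c0_norm x"
      using c0_coord_le[OF x] order_trans[OF norm_ge_zero c0_coord_le[OF x, of 0]]
      by (simp add: forward_shift_def)
    show "cmod (x j) \<le> c0_norm (forward_shift n x)"
      using c0_coord_le[of "forward_shift n x" "j + n"] x iff by (simp add: shift)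
  qed
  show "(\<lambda>n. c0_norm (\<lambda>j. x (j + n))) \<longlonglongrightarrow> 0" if x: "x \<in> c0"
  proof (rule LIMSEQ_I)
    fix e :: real assume e: "e > 0"
    then obtain m where m: "\<And>j. j \<ge> m \<Longrightarrow> cmod (x j) < e / 2"
      using LIMSEQ_D[of x 0 "e / 2"] x by (auto simp: c0_def)
    have "norm (c0_norm (\<lambda>j. x (j + n)) - 0) < e" if "n \<ge> m" for n
    proof -
      have "c0_norm (\<lambda>j. x (j + n)) \<le> e / 2"
        using that m by (intro c0_norm_le less_imp_le) simp
      moreover have "(\<lambda>j. x (j + n)) \<in> c0"
        using x LIMSEQ_ignore_initial_segment[of x 0 n] by (simp add: c0_def)
      then have "0 \<le> c0_norm (\<lambda>j. x (j + n))"
        using c0_coord_le[of "\<lambda>j. x (j + n)" 0] norm_ge_zero order_trans by blast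
      ultimately show ?thesis using e by simp
    qed
    then show "\<exists>m. \<forall>n\<ge>m. norm (c0_norm (\<lambda>j. x (j + n)) - 0) < e" by blast
  qed
  show "(\<lambda>j. if j = 0 then 1 else 0) \<in> c0"
    unfolding c0_def by (auto intro!: tendsto_eventually eventually_sequentiallyI[of 1])
qed (auto intro: Metric_space_c0 c0_coord_le)

lemma solid_sequence_space_lp:
  assumes p: "p \<ge> 1"
  shows "solid_sequence_space (lp p) (lp_norm p)"
proof (rule solid_sequence_space.intro)
  fix x y :: "nat \<Rightarrow> complex" and c :: complex and n j :: nat
  show "Metric_space (lp p) (norm_dist (lp p) (lp_norm p))"
    using p by (rule Metric_space_lp)
  show "(\<lambda>j. x j + y j) \<in> lp p" if "x \<in> lp p" "y \<in> lp p"
    using lp_Minkowski(1)[OF p that] .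
  show "lp_norm p (\<lambda>j. x j + y j) \<le> lp_norm p x + lp_norm p y" if "x \<in> lp p" "y \<in> lp p"
    using lp_Minkowski(2)[OF p that] .
  show "(\<lambda>j. c * x j) \<in> lp p" if "x \<in> lp p"
    using that by (simp add: lp_def norm_mult powr_mult summable_mult)
  show "lp_norm p (\<lambda>j. c * x j) = cmod c * lp_norm p x" if x: "x \<in> lp p"
  proof -
    have "(\<Sum>j. cmod (c * x j) powr p) = cmod c powr p * (\<Sum>j. cmod (x j) powr p)"
      using x by (simp add: lp_def norm_mult powr_mult suminf_mult)
    moreover have "0 \<le> (\<Sum>j. cmod (x j) powr p)"
      using x by (intro suminf_nonneg) (auto simp: lp_def)
    ultimately show ?thesis
      using p by (simp add: lp_norm_def powr_mult powr_powr)
  qed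
  show solid: "x \<in> lp p" if "y \<in> lp p" "\<And>j. cmod (x j) \<le> cmod (y j)"
    unfolding lp_def mem_Collect_eq
  proof (rule summable_comparison_test'[of _ 0])
    show "summable (\<lambda>j. cmod (y j) powr p)" using that by (simp add: lp_def)
    show "norm (cmod (x n) powr p) \<le> cmod (y n) powr p" for n
      using that p by (simp add: powr_mono2)
  qed
  show "lp_norm p x \<le> lp_norm p y" if "y \<in> lp p" "\<And>j. cmod (x j) \<le> cmod (y j)"
    unfolding lp_norm_def using that solid[OF that] p
    by (intro powr_mono2 suminf_le suminf_nonneg) (auto simp: lp_def powr_mono2)
  have shift: "forward_shift n x (j + n) = x j" for j
    by (simp add: forward_shift_def)
  show iff: "forward_shift n x \<in> lp p \<longleftrightarrow> x \<in> lp p"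
    using summable_iff_shift[of "\<lambda>j. cmod (forward_shift n x j) powr p" n]
    by (simp add: lp_def shift)
  show "lp_norm p (forward_shift n x) = lp_norm p x" if x: "x \<in> lp p"
  proof -
    have "(\<Sum>i<n. cmod (forward_shift n x i) powr p) = 0"
      by (simp add: forward_shift_def)
    then show ?thesis
      using suminf_split_initial_segment[of "\<lambda>j. cmod (forward_shift n x j) powr p" n] x iff
      by (simp add: lp_norm_def lp_def shift)
  qed
  show "(\<lambda>n. lp_norm p (\<lambda>j. x (j + n))) \<longlonglongrightarrow> 0" if x: "x \<in> lp p"
    unfolding lp_norm_def
  proof (rule tendsto_zero_powrI)
    have sm: "summable (\<lambda>j. cmod (x j) powr p)" using x by (simp add: lp_def)
    show "(\<lambda>n. \<Sum>j. cmod (x (j + n)) powr p) \<longlonglongrightarrow> 0"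
      using suminf_exist_split[OF _ sm] by (intro LIMSEQ_I) auto
    show "\<forall>\<^sub>F n in sequentially. 0 \<le> (\<Sum>j. cmod (x (j + n)) powr p)"
      by (intro always_eventually allI suminf_nonneg summable_ignore_initial_segment[OF sm]) simp
  qed (use p in auto)
  show "(\<lambda>j. if j = 0 then 1 else 0) \<in> lp p"
    unfolding lp_def mem_Collect_eq by (rule summable_finite[of "{0}"]) auto
  show "cmod (x j) \<le> lp_norm p x" if x: "x \<in> lp p"
  proof -
    have "cmod (x j) powr p \<le> (\<Sum>j. cmod (x j) powr p)"
      using sum_le_suminf[of "\<lambda>j. cmod (x j) powr p" "{j}"] x by (simp add: lp_def)
    then have "(cmod (x j) powr p) powr (1 / p) \<le> lp_norm p x"
      unfolding lp_norm_def using p by (intro powr_mono2) auto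
    then show ?thesis using p by (simp add: powr_powr)
  qed
qed

section \<open>A height function on the natural numbers\<close>

text \<open>The least cost of a path to \<open>m\<close> from a number of the form \<open>l * fact l\<close>, where adding
  \<open>1\<close> and subtracting a factorial cost one unit each. The subtractions come last and are written
  on the left-hand side, because subtraction is truncated. Equivalently, this is the largest function
  that vanishes at the dips \<open>l * fact l\<close>, increases by at most \<open>1\<close> per step and satisfies
  \<open>height m \<le> height (m + fact k) + 1\<close>.\<close>
definition height :: "nat \<Rightarrow> nat" where
  "height m = (LEAST r. \<exists>l t ks. m + sum_list (map fact ks) = l * fact l + t \<and> r = length ks + t)"

lemma height_le:
  assumes "m + sum_list (map fact ks) = l * fact l + t"
  shows "height m \<le> length ks + t"
  unfolding height_def using assms by (intro Least_le) blast

lemma height_attained: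
  obtains l t ks where "m + sum_list (map fact ks) = l * fact l + t" "height m = length ks + t"
proof -
  have "\<exists>l t ks. m + sum_list (map fact ks) = l * fact l + t \<and> height m = length ks + t"
    unfolding height_def
    by (rule LeastI[of _ m]) (intro exI[of _ 0] exI[of _ m] exI[of _ "[]"], simp)
  then show thesis using that by blast
qed

lemma height_eq_0: "height (l * fact l) = 0"
  using height_le[of "l * fact l" "[]" l 0] by simp

lemma height_Suc: "height (Suc m) \<le> Suc (height m)"
proof -
  obtain l t ks where "m + sum_list (map fact ks) = l * fact l + t" "height m = length ks + t"
    by (rule height_attained)
  then show ?thesis using height_le[of "Suc m" ks l "Suc t"] by simp
qed

lemma height_le_add_fact: "height m \<le> Suc (height (m + fact k))"
proof -
  obtain l t ks where "m + fact k + sum_list (map fact ks) = l * fact l + t"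
      "height (m + fact k) = length ks + t"
    by (rule height_attained)
  then show ?thesis using height_le[of m "k # ks" l t] by (simp add: add.assoc)
qed

text \<open>The dips \<open>l * fact l\<close> are far, in cost, from the factorials. A dip below \<open>fact k\<close>
  needs at least \<open>fact (k - 1)\<close> additions of \<open>1\<close>, because
  \<open>fact (i + 1) - i * fact i = fact i\<close>. From a dip with \<open>l \<ge> k\<close>, factorials up to
  \<open>fact l\<close> have to be subtracted almost \<open>l\<close> times, and a larger factorial can only be
  subtracted after at least \<open>fact l\<close> additions, by the same identity.\<close>
lemma height_fact_add:
  assumes "j < k"
  shows "k \<le> Suc (height (fact k + j))"
proof -
  obtain l t ks where eq: "fact k + j + sum_list (map fact ks) = l * fact l + t"
      and h: "height (fact k + j) = length ks + t"
    by (rule height_attained)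
  have gap: "fact i \<le> t" if "fact (Suc i) \<le> i * fact i + t" for i :: nat
    using that by simp
  have "k \<le> Suc (length ks + t)"
  proof (cases "l < k")
    case True
    then obtain i where k: "k = Suc i" and "l \<le> i" by (cases k) auto
    then have "l * fact l \<le> i * fact i" by (intro mult_mono fact_mono_nat) auto
    then have "fact i \<le> t" using eq unfolding k by (intro gap) linarith
    then show ?thesis using k fact_ge_self[of i] by linarith
  next
    case False
    show ?thesis
    proof (cases "\<forall>i\<in>set ks. i \<le> l")
      case True
      have "sum_list (map fact ks) \<le> sum_list (map (\<lambda>_. fact l :: nat) ks)"
        using True by (intro sum_list_mono fact_mono_nat) auto
      then have s: "sum_list (map fact ks) \<le> length ks * fact l"
        by (simp add: sum_list_triv)
      have "fact k \<le> (fact l :: nat)" using False by (intro fact_mono_nat) auto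
      moreover have "j < fact l" using assms False fact_ge_self[of l] by linarith
      ultimately have "l * fact l < (length ks + 2) * fact l"
        using eq s by (simp add: algebra_simps)
      then have "l < length ks + 2" by (simp only: mult_less_cancel2)
      then show ?thesis using False by linarith
    next
      case large: False
      from large obtain i where i: "i \<in> set ks" "Suc l \<le> i" by auto
      have "fact (Suc l) \<le> (fact i :: nat)" using i(2) by (rule fact_mono_nat)
      also have "\<dots> \<le> sum_list (map fact ks)" using i(1) by (intro member_le_sum_list) auto
      finally have "fact l \<le> t" using eq by (intro gap) linarith
      then show ?thesis using False fact_ge_self[of l] by linarith
    qed
  qed
  then show ?thesis using h by simp
qed

section \<open>The weight\<close>

definition dipping_weight :: "nat \<Rightarrow> real" where
  "dipping_weight n = 2 ^ height n / 2 ^ height (n - 1)"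

lemma dipping_weight_pos: "0 < dipping_weight n"
  by (simp add: dipping_weight_def)

lemma dipping_weight_le: "dipping_weight n \<le> 2"
proof (cases n)
  case (Suc m)
  have "(2::real) ^ height (Suc m) \<le> 2 ^ Suc (height m)"
    using height_Suc by (rule power_increasing) simp
  then show ?thesis using Suc by (simp add: dipping_weight_def field_simps)
qed (simp add: dipping_weight_def)

lemma weight_sequence_dipping_weight: "weight_sequence dipping_weight"
  unfolding weight_sequence_def bounded_iff
  using dipping_weight_le
  by (auto simp: dipping_weight_pos abs_of_pos intro!: exI[of _ 2])

text \<open>The product of the first \<open>n\<close> weights is \<open>2 ^ height n\<close>. Shifting by factorials makes
  these products grow at every fixed coordinate, while losing at most a factor \<open>2\<close> uniformly over all coordinates; along
  \<open>l * fact l\<close> they return to their initial value \<open>2 ^ height 0 = 1\<close>.\<close>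
lemma (in solid_sequence_space) dipping_weight_shift:
  "continuous_linear_operator X N (backward_shift dipping_weight)"
  "ultra_hypercyclic X N (backward_shift dipping_weight)"
  "\<not> mixing X N (backward_shift dipping_weight)"
proof -
  define v :: "nat \<Rightarrow> real" where "v n = 2 ^ height n" for n
  have w: "dipping_weight = (\<lambda>n. v n / v (n - 1))"
    by (simp add: dipping_weight_def v_def fun_eq_iff)
  have v: "v n > 0" for n by (simp add: v_def)
  have bound: "v j \<le> 2 * v (j + fact k)" for j k
    using power_increasing[OF height_le_add_fact, of "2::real"] by (simp add: v_def)
  have step: "v (Suc n) \<le> 2 * v n" for n
    using power_increasing[OF height_Suc, of "2::real"] by (simp add: v_def)
  have lim: "(\<lambda>k. v j / v (j + fact k)) \<longlonglongrightarrow> 0" for j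
  proof (rule tendsto_sandwich[OF _ _ tendsto_const])
    show "(\<lambda>k. v j * 2 * (1 / 2) ^ k) \<longlonglongrightarrow> 0"
      by (intro tendsto_mult_right_zero LIMSEQ_realpow_zero) auto
    have "v j / v (j + fact k) \<le> v j * 2 * (1 / 2) ^ k" if "k > j" for k
    proof -
      have "(2::real) ^ k \<le> 2 * v (j + fact k)"
        using power_increasing[OF height_fact_add[OF that], of "2::real"]
        by (simp add: v_def add.commute)
      then have "v j * 2 ^ k \<le> v j * (2 * v (j + fact k))"
        using v[of j] by (intro mult_left_mono) auto
      then show ?thesis using v[of "j + fact k"] by (simp add: field_simps power_divide)
    qed
    then show "\<forall>\<^sub>F k in sequentially. v j / v (j + fact k) \<le> v j * 2 * (1 / 2) ^ k"
      by (auto simp: eventually_sequentially intro!: exI[of _ "Suc j"])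
    show "\<forall>\<^sub>F k in sequentially. 0 \<le> v j / v (j + fact k)"
      by (simp add: v_def)
  qed
  show "continuous_linear_operator X N (backward_shift dipping_weight)"
    using dipping_weight_le
    by (intro continuous_linear_backward_shift[of _ 2]) (simp add: dipping_weight_pos abs_of_pos)
  show "ultra_hypercyclic X N (backward_shift dipping_weight)"
    unfolding w using v step _ _ bound lim
  proof (rule ultra_hypercyclic_backward_shift)
    show "strict_mono_on {1..} (fact :: nat \<Rightarrow> nat)"
      by (auto simp: strict_mono_on_def intro: fact_less_mono_nat)
  qed (simp add: fact_ge_1)
  have "inj_on (\<lambda>l::nat. l * fact l) UNIV"
    by (intro strict_mono_imp_inj_on strict_monoI mult_less_le_imp_less fact_mono_nat) auto
  then have "infinite (range (\<lambda>l::nat. l * fact l))"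
    by (rule range_inj_infinite)
  moreover have "range (\<lambda>l. l * fact l) \<subseteq> {n. v n \<le> 1 * v 0}"
    by (auto simp: v_def height_eq_0)
  ultimately have "infinite {n. v n \<le> 1 * v 0}"
    using finite_subset by blast
  then show "\<not> mixing X N (backward_shift dipping_weight)"
    unfolding w using v by (intro not_mixing_backward_shift)
qed

theorem theorem2p7:
  shows "(\<exists>w. weight_sequence w \<and>
              continuous_linear_operator c0 c0_norm (backward_shift w) \<and>
              ultra_hypercyclic c0 c0_norm (backward_shift w) \<and>
              \<not> mixing c0 c0_norm (backward_shift w)) \<and>
         (\<forall>p::real. p \<ge> 1 \<longrightarrow>
            (\<exists>w. weight_sequence w \<and>
                 continuous_linear_operator (lp p) (lp_norm p) (backward_shift w) \<and>
                 ultra_hypercyclic (lp p) (lp_norm p) (backward_shift w) \<and>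
                 \<not> mixing (lp p) (lp_norm p) (backward_shift w)))"
  using weight_sequence_dipping_weight
    solid_sequence_space.dipping_weight_shift[OF solid_sequence_space_c0]
    solid_sequence_space.dipping_weight_shift[OF solid_sequence_space_lp]
  by (intro conjI allI impI exI[of _ dipping_weight])

end
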